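(* Suppose that the following conditions hold. (1) The observations $Y_1,\dots,Y_n$ are independent. (2) For some constants $0<\mathfrak u_0<\mathfrak u<1$ and all $k=2,\dots,K$, $\mathfrak u_0\le\|D_k^{-1}D_{k-1}^2D_k^{-1}\|\le\mathfrak u$, where $\|\cdot\|$ is the spectral norm. (3) For a constant $\mathfrak a>0$ and all $k=1,\dots,K$, $V_k^2\le\mathfrak a^2D_k^2$ in the sense of symmetric matrices. (4) For some fixed $\delta<1/2$ and $\rho>0$, $|\ell_i(u)/\ell_i(0)-1|\le\delta$ for all $|u|\le\rho$ and all $i$. (5) The kernel $K_{\mathrm{loc}}$ is symmetric, $K_{\mathrm{loc}}(0)=1$, $K_{\mathrm{loc}}(u)$ decreases in $u\ge0$, and $K_{\mathrm{loc}}(u)=0$ for $|u|\ge1$. Let $\theta^*\in\Theta$, $\Delta>0$ and $k^*\le K$ be such that $\Delta_{k^*}(\theta^* )\le\Delta$. Let the critical values $\mathfrak z_1,\dots,\mathfrak z_{K-1}$ satisfy the propagation condition under $\mathbf P_{\theta^*}$ with parameters $\alpha>0$, $r>0$ and risk bound $\mathcal R_r$. Then the adaptive estimator $\hat\theta(x)$ satisfies $$\mathbf E\log\Big\{1+\frac{L^r\big(W^{(k^* )},\tilde\theta_{k^*}(x),\hat\theta(x)\big)}{\mathcal R_r}\Big\}\le\alpha+\Delta+\log\Big(1+\frac{\mathfrak z_{k^*}}{\mathcal R_r}\Big),$$ where $\mathbf E$ is the expectation under the true distribution $\mathbf P$ of the data.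
   Context: Model. Fix $\tau\in(0,1)$ and deterministic design points $X_1,\dots,X_n\in\mathbb R$. The responses $Y_1,\dots,Y_n$ are independent real random variables with joint distribution $\mathbf P$. The quantile function $f$ is defined by $\mathbf P\{Y_i>f(X_i)\}=\tau$ (assumed to have a unique solution for each $i$). Put $\varepsilon_i=Y_i-f(X_i)$; let $\ell_i$ be the density of $\varepsilon_i$. Local likelihood. Fix a point $x$, a degree $p\ge0$ and $\Theta\subseteq\mathbb R^{p+1}$. Let $\Psi_i=(1,X_i-x,(X_i-x)^2/2!,\dots,(X_i-x)^p/p!)^\top$ and $\rho_\tau(u)=u\{\tau-\mathbf 1(u<0)\}$. For bandwidths $0<h_1<\dots<h_K$ and a kernel $K_{\mathrm{loc}}$, set $w_i^{(k)}=K_{\mathrm{loc}}\{(X_i-x)/h_k\}$, $W^{(k)}=(w_1^{(k)},\dots,w_n^{(k)})$, and $$L(W^{(k)},\theta)=\log\{\tau(1-\tau)\}\sum_{i=1}^n w_i^{(k)}-\sum_{i=1}^n\rho_\tau(Y_i-\Psi_i^\top\theta)w_i^{(k)}.$$ Let $\tilde\theta_k(x)=\operatorname{argmax}_{\theta\in\Theta}L(W^{(k)},\theta)$. Write $L(W,\theta,\theta')=L(W,\theta)-L(W,\theta')$ and $L^r(\cdot)=\{L(\cdot)\}^r$. Matrices. $D_k^2=\sum_i\Psi_i\Psi_i^\top\ell_i(0)w_i^{(k)}$ and $V_k^2=\tau(1-\tau)\sum_i\Psi_i\Psi_i^\top|w_i^{(k)}|^2$, with $D_k$ the symmetric square root of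 $D_k^2$. Adaptive procedure. Given critical values $\mathfrak z_1,\dots,\mathfrak z_{K-1}$: $\tilde\theta_1(x)$ is accepted and $\hat\theta_1(x)=\tilde\theta_1(x)$. For $k\ge2$, $\tilde\theta_k(x)$ is accepted and $\hat\theta_k(x)=\tilde\theta_k(x)$ if $\tilde\theta_{k-1}(x)$ was accepted and $L(W^{(\ell)},\tilde\theta_\ell(x),\tilde\theta_k(x))\le\mathfrak z_\ell$ for all $\ell=1,\dots,k-1$; otherwise $\hat\theta_k(x)=\hat\theta_{k-1}(x)$. The adaptive estimator is $\hat\theta(x)=\hat\theta_K(x)$. If $k^*=K$, $\mathfrak z_K$ denotes an arbitrary fixed nonnegative number. Parametric measure. For $\theta\in\Theta$, $\mathbf P_\theta=\prod_iP_{i,f_i(\theta)}$ is the product measure under which $Y_i=\Psi_i^\top\theta+\varepsilon_i$ with independent $\varepsilon_i$ having the same laws as under $\mathbf P$. Here $P_{i,s}$ is the law of $s+\varepsilon_i$, $f_i(\theta)=\Psi_i^\top\theta$, $f_i=f(X_i)$, so that $\mathbf P=\prod_iP_{i,f_i}$. $\mathbf E_\theta$ is expectation under $\mathbf P_\theta$. Modeling bias. $\Delta_k(\theta)=\sum_{i=1}^n\mathrm{KL}(P_{i,f_i},P_{i,f_i(\theta)})\mathbf 1\{w_i^{(k)}>0\}$, where $\mathrm{KL}(P,Q)=\mathbf E_P\log(dP/dQ)$ is the Kullback-Leibler divergence. Propagation condition under $\mathbf P_{\theta^*}$. $\mathcal R_r>0$ is a constant with $\mathbf E_{\theta^*}L^r(W^{(k)},\tilde\theta_k(x),\theta^*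 )\le\mathcal R_r$ for all $k\le K$, and the critical values are such that $\mathbf E_{\theta^*}L^r(W^{(k)},\tilde\theta_k(x),\hat\theta_k(x))\le\alpha\mathcal R_r$ for $k=2,\dots,K$.
   Formalization: The bound is proved with the r-th power of the critical value z_{k*} in the last logarithm instead of z_{k*} itself (the printed bound is false for r ≠ 1), and z_{k*} is assumed nonnegative also for k* < K (for negative z_{k*} the claim fails). *)

theory Defs
  imports "HOL-Probability.Probability"
begin

definition check_loss :: "real \<Rightarrow> real \<Rightarrow> real" where
  "check_loss \<tau> u = u * (\<tau> - of_bool (u < 0))"

(* Vectors in R^(p+1) are rendered as real^'m; the bijection ix from 'm onto {0..p} tells which
   monomial a coordinate stands for. *)
definition local_basis :: "('m::finite \<Rightarrow> nat) \<Rightarrow> real \<Rightarrow> real \<Rightarrow> real^'m" where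
  "local_basis ix x u = (\<chi> j. (u - x) ^ ix j / fact (ix j))"

definition quasi_loglik ::
  "real \<Rightarrow> nat \<Rightarrow> (nat \<Rightarrow> real^'m::finite) \<Rightarrow> (nat \<Rightarrow> real) \<Rightarrow> (nat \<Rightarrow> real) \<Rightarrow> real^'m \<Rightarrow> real" where
  "quasi_loglik \<tau> n \<Psi> y w \<theta> =
     ln (\<tau> * (1 - \<tau>)) * (\<Sum>i=1..n. w i)
     - (\<Sum>i=1..n. check_loss \<tau> (y i - \<Psi> i \<bullet> \<theta>) * w i)"

definition quasi_lr ::
  "real \<Rightarrow> nat \<Rightarrow> (nat \<Rightarrow> real^'m::finite) \<Rightarrow> (nat \<Rightarrow> real) \<Rightarrow> (nat \<Rightarrow> real)
     \<Rightarrow> real^'m \<Rightarrow> real^'m \<Rightarrow> real" where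
  "quasi_lr \<tau> n \<Psi> y w \<theta> \<theta>' = quasi_loglik \<tau> n \<Psi> y w \<theta> - quasi_loglik \<tau> n \<Psi> y w \<theta>'"

(* est y is argmax over Theta of L(w, .) for the data y.  A maximiser need not be unique.  The last
   clause says that "argmax" is a function of the objective L(w, .) alone, so that ties are not
   broken by means of observations that do not enter the objective. *)
definition argmax_estimator ::
  "real \<Rightarrow> nat \<Rightarrow> (nat \<Rightarrow> real^'m::finite) \<Rightarrow> (real^'m) set \<Rightarrow> (nat \<Rightarrow> real)
     \<Rightarrow> ((nat \<Rightarrow> real) \<Rightarrow> real^'m) \<Rightarrow> bool" where
  "argmax_estimator \<tau> n \<Psi> \<Theta> w est \<longleftrightarrow>
     est \<in> borel_measurable (PiM {1..n} (\<lambda>_. borel)) \<and>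
     (\<forall>y. is_arg_max (quasi_loglik \<tau> n \<Psi> y w) (\<lambda>\<theta>. \<theta> \<in> \<Theta>) (est y)) \<and>
     (\<forall>y y'. quasi_loglik \<tau> n \<Psi> y w = quasi_loglik \<tau> n \<Psi> y' w \<longrightarrow> est y = est y')"

definition outer_square :: "real^'m::finite \<Rightarrow> real^'m^'m" where
  "outer_square v = (\<chi> i j. v $ i * v $ j)"

definition D_squared ::
  "nat \<Rightarrow> (nat \<Rightarrow> real^'m::finite) \<Rightarrow> (nat \<Rightarrow> real \<Rightarrow> real) \<Rightarrow> (nat \<Rightarrow> real) \<Rightarrow> real^'m^'m" where
  "D_squared n \<Psi> dens w = (\<Sum>i=1..n. (dens i 0 * w i) *\<^sub>R outer_square (\<Psi> i))"

definition V_squared ::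
  "real \<Rightarrow> nat \<Rightarrow> (nat \<Rightarrow> real^'m::finite) \<Rightarrow> (nat \<Rightarrow> real) \<Rightarrow> real^'m^'m" where
  "V_squared \<tau> n \<Psi> w = (\<tau> * (1 - \<tau>)) *\<^sub>R (\<Sum>i=1..n. \<bar>w i\<bar>\<^sup>2 *\<^sub>R outer_square (\<Psi> i))"

definition psd_matrix :: "real^'m::finite^'m \<Rightarrow> bool" where
  "psd_matrix A \<longleftrightarrow> transpose A = A \<and> (\<forall>v. 0 \<le> v \<bullet> (A *v v))"

definition matrix_sqrt :: "real^'m::finite^'m \<Rightarrow> real^'m^'m" where
  "matrix_sqrt A = (THE B. psd_matrix B \<and> B ** B = A)"

definition spectral_norm :: "real^'m::finite^'m \<Rightarrow> real" where
  "spectral_norm A = onorm ((*v) A)"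

(* In both recursions step 0 is a dummy: accepted ... 1 is True and adaptive ... 1 is est 1. *)
primrec accepted ::
  "('t \<Rightarrow> nat \<Rightarrow> 't \<Rightarrow> real) \<Rightarrow> (nat \<Rightarrow> real) \<Rightarrow> (nat \<Rightarrow> 't) \<Rightarrow> nat \<Rightarrow> bool" where
  "accepted LR z est 0 \<longleftrightarrow> True"
| "accepted LR z est (Suc k) \<longleftrightarrow>
     accepted LR z est k \<and> (\<forall>l\<in>{1..k}. LR (est l) l (est (Suc k)) \<le> z l)"

primrec adaptive ::
  "('t \<Rightarrow> nat \<Rightarrow> 't \<Rightarrow> real) \<Rightarrow> (nat \<Rightarrow> real) \<Rightarrow> (nat \<Rightarrow> 't) \<Rightarrow> nat \<Rightarrow> 't" where
  "adaptive LR z est 0 = est 0"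
| "adaptive LR z est (Suc k) =
     (if accepted LR z est (Suc k) then est (Suc k) else adaptive LR z est k)"

(* The theory HOL-Probability.Information computes the divergence by a Bochner integral, which is 0
   when the integral diverges, and it does not test absolute continuity.  Here both cases give
   infinity.  (In KL_divergence b M N the reference measure M comes first.) *)
definition KL :: "real measure \<Rightarrow> real measure \<Rightarrow> ereal" where
  "KL P Q = (if absolutely_continuous Q P \<and> integrable P (entropy_density (exp 1) Q P)
             then ereal (KL_divergence (exp 1) Q P) else \<infinity>)"

definition shifted_law :: "'a measure \<Rightarrow> ('a \<Rightarrow> real) \<Rightarrow> real \<Rightarrow> real measure" where
  "shifted_law M e s = distr M borel (\<lambda>\<omega>. s + e \<omega>)"

definition param_measure ::
  "'a measure \<Rightarrow> nat \<Rightarrow> (nat \<Rightarrow> 'a \<Rightarrow> real) \<Rightarrow> (nat \<Rightarrow> real^'m::finite) \<Rightarrow> real^'m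
     \<Rightarrow> (nat \<Rightarrow> real) measure" where
  "param_measure M n \<epsilon> \<Psi> \<theta> = PiM {1..n} (\<lambda>i. shifted_law M (\<epsilon> i) (\<Psi> i \<bullet> \<theta>))"

definition modeling_bias ::
  "'a measure \<Rightarrow> nat \<Rightarrow> (nat \<Rightarrow> 'a \<Rightarrow> real) \<Rightarrow> (nat \<Rightarrow> real^'m::finite) \<Rightarrow> (nat \<Rightarrow> real)
     \<Rightarrow> (nat \<Rightarrow> real) \<Rightarrow> real^'m \<Rightarrow> ereal" where
  "modeling_bias M n \<epsilon> \<Psi> fX w \<theta> =
     (\<Sum>i=1..n. KL (shifted_law M (\<epsilon> i) (fX i)) (shifted_law M (\<epsilon> i) (\<Psi> i \<bullet> \<theta>))
               * indicator {i. 0 < w i} i)"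

end

theory Submission
  imports Defs
begin

text \<open>
  The loss of an estimate is the \<open>r\<close>-th power of the likelihood ratio of the local estimate at the
  oracle step \<open>k\<^sup>*\<close> against it. For every data vector (\<open>adaptive_loss_le\<close>), the procedure either
  accepts step \<open>k\<^sup>*\<close>, and then every estimate accepted later has passed the test against step \<open>k\<^sup>*\<close>,
  so that its loss is at most the \<open>r\<close>-th power of the critical value; or it rejects step \<open>k\<^sup>*\<close>, and
  then the final estimate is the adaptive estimate at step \<open>k\<^sup>*\<close>. Hence the loss of the final estimate
  is at most the sum of this power and the loss of the adaptive estimate at step \<open>k\<^sup>*\<close>, and
  \<open>ln (1 + a + b) \<le> ln (1 + a) + ln (1 + b)\<close> separates the two contributions.

  The second loss, divided by the risk bound \<open>R\<close> and called \<open>\<xi>\<close> below, is controlled by the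
  propagation condition, but only under the parametric measure \<open>Q\<close>. Passing to the true measure
  \<open>P\<close> costs the Kullback--Leibler divergence: the mean of \<open>ln (1 + \<xi>)\<close> under \<open>P\<close> is at most the
  divergence plus the mean of \<open>\<xi>\<close> under \<open>Q\<close> (\<open>nn_integral_ln_le_KL_plus_expectation\<close>), hence at
  most \<open>\<Delta> + \<alpha>\<close>.

  The modeling bias contains only the coordinates whose weight at step \<open>k\<^sup>*\<close> is positive, whereas the
  two measures may be mutually singular in the others. So the change of measure takes place
  on the product over these coordinates alone. This is legitimate because \<open>\<xi>\<close> depends on no other
  observation: the weights increase with the bandwidth
  (\<open>kernel_weight_pos_of_smaller_bandwidth\<close>), so the objectives up to step \<open>k\<^sup>*\<close> involve only
  these coordinates (\<open>quasi_loglik_cong\<close>), and with them the estimates and the accept-reject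
  decisions.
\<close>

section \<open>Change of measure on product spaces\<close>

text \<open>
  Undoing the density \<open>dP/dQ\<close>, whose logarithm is the entropy density, turns the
  integral over \<open>P\<close> back into one over \<open>Q\<close>, but only over the set where the density is
  positive; hence an inequality. Where the density vanishes its logarithm takes the default value
  \<open>0\<close>, which does no harm since that set is null for \<open>P\<close>.
\<close>
lemma nn_integral_inverse_density_le:
  assumes "sigma_finite_measure Q" "finite_measure P" "absolutely_continuous Q P"
    and sets_eq: "sets P = sets Q" and g [measurable]: "g \<in> borel_measurable Q"
  shows "(\<integral>\<^sup>+ x. g x * ennreal (exp (- entropy_density (exp 1) Q P x)) \<partial>P) \<le> (\<integral>\<^sup>+ x. g x \<partial>Q)"
proof -
  interpret Q: sigma_finite_measure Q by fact
  interpret P: finite_measure P by fact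
  let ?s = "entropy_density (exp 1) Q P" and ?D = "RN_deriv Q P"
  have fin: "AE x in Q. ?D x \<noteq> \<infinity>"
    by (rule Q.RN_deriv_finite) (use assms in \<open>auto intro: P.sigma_finite_measure_axioms\<close>)
  have "(\<integral>\<^sup>+ x. g x * ennreal (exp (- ?s x)) \<partial>P) = (\<integral>\<^sup>+ x. ?D x * (g x * ennreal (exp (- ?s x))) \<partial>Q)"
    by (rule Q.RN_deriv_nn_integral) (use assms in auto)
  also have "\<dots> \<le> (\<integral>\<^sup>+ x. g x \<partial>Q)"
  proof (rule nn_integral_mono_AE, use fin in eventually_elim)
    fix x assume "?D x \<noteq> \<infinity>"
    then obtain d where d: "?D x = ennreal d" "0 \<le> d" by (cases "?D x") auto
    then have "?D x * ennreal (exp (- ?s x)) \<le> 1"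
      by (cases "d = 0")
        (auto simp: entropy_density_def log_def exp_minus simp flip: ennreal_mult'' ennreal_1)
    then have "g x * (?D x * ennreal (exp (- ?s x))) \<le> g x * 1" by (intro mult_left_mono) auto
    then show "?D x * (g x * ennreal (exp (- ?s x))) \<le> g x" by (simp add: ac_simps)
  qed
  finally show ?thesis .
qed

text \<open>
  One-dimensional changes of measure tensorize: by Tonelli one coordinate can be exchanged at a
  time, with the remaining weights carried along. This replaces the computation of the density of
  one product measure with respect to another.
\<close>
lemma nn_integral_PiM_reweight_le:
  fixes q :: "'i \<Rightarrow> 'b \<Rightarrow> ennreal"
  assumes "product_sigma_finite P" "product_sigma_finite Q" "finite J"
    and sets_eq: "\<And>i. sets (P i) = sets (Q i)"
    and q: "\<And>i. i \<in> J \<Longrightarrow> q i \<in> borel_measurable (Q i)"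
    and le: "\<And>i g. i \<in> J \<Longrightarrow> g \<in> borel_measurable (Q i) \<Longrightarrow>
      (\<integral>\<^sup>+ x. g x * q i x \<partial>P i) \<le> (\<integral>\<^sup>+ x. g x \<partial>Q i)"
    and F: "F \<in> borel_measurable (PiM J Q)"
  shows "(\<integral>\<^sup>+ y. F y * (\<Prod>i\<in>J. q i (y i)) \<partial>PiM J P) \<le> (\<integral>\<^sup>+ y. F y \<partial>PiM J Q)"
  using assms(3) q le F
proof (induction J arbitrary: F)
  case empty
  show ?case by (simp add: PiM_empty)
next
  case (insert i J)
  interpret P: product_sigma_finite P by fact
  interpret Q: product_sigma_finite Q by fact
  have sets_PiM_eq: "sets (PiM L P) = sets (PiM L Q)" for L
    by (rule sets_PiM_cong) (simp_all add: sets_eq)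
  have [measurable]: "q i \<in> borel_measurable (Q i)" "F \<in> borel_measurable (PiM (insert i J) Q)"
    using insert.prems by auto
  have prod_measurable: "(\<lambda>y. \<Prod>j\<in>L. q j (y j)) \<in> borel_measurable (PiM L Q)"
    if "L \<subseteq> insert i J" for L
    using insert.prems(1) that
    by (intro borel_measurable_prod_ennreal) (metis measurable_PiM_component_rev subsetD)
  have m: "(\<lambda>x. F (y(i := x))) \<in> borel_measurable (Q i)" if "y \<in> space (PiM J Q)" for y
  proof (rule measurable_compose[OF _ insert.prems(3)])
    show "(\<lambda>x. y(i := x)) \<in> measurable (Q i) (PiM (insert i J) Q)"
      using that by (intro measurable_fun_upd[where J = J]) auto
  qed
  have "(\<lambda>y. F y * (\<Prod>j\<in>insert i J. q j (y j))) \<in> borel_measurable (PiM (insert i J) Q)"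
    by (intro borel_measurable_times_ennreal prod_measurable insert.prems(3) order_refl)
  then have FP: "(\<lambda>y. F y * (\<Prod>j\<in>insert i J. q j (y j))) \<in> borel_measurable (PiM (insert i J) P)"
    unfolding measurable_cong_sets[OF sets_PiM_eq refl] .
  have "(\<integral>\<^sup>+ y. F y * (\<Prod>j\<in>insert i J. q j (y j)) \<partial>PiM (insert i J) P)
      = (\<integral>\<^sup>+ y. (\<integral>\<^sup>+ x. F (y(i := x)) * (\<Prod>j\<in>insert i J. q j ((y(i := x)) j)) \<partial>P i) \<partial>PiM J P)"
    by (rule P.product_nn_integral_insert[OF insert.hyps FP])
  also have "\<dots> = (\<integral>\<^sup>+ y. (\<integral>\<^sup>+ x. F (y(i := x)) * q i x \<partial>P i) * (\<Prod>j\<in>J. q j (y j)) \<partial>PiM J P)"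
  proof (rule nn_integral_cong)
    fix y assume "y \<in> space (PiM J P)"
    then have y: "y \<in> space (PiM J Q)" using sets_eq_imp_space_eq[OF sets_PiM_eq] by auto
    have "(\<Prod>j\<in>J. q j ((y(i := x)) j)) = (\<Prod>j\<in>J. q j (y j))" for x
      using insert.hyps by (intro prod.cong) auto
    then show "(\<integral>\<^sup>+ x. F (y(i := x)) * (\<Prod>j\<in>insert i J. q j ((y(i := x)) j)) \<partial>P i)
        = (\<integral>\<^sup>+ x. F (y(i := x)) * q i x \<partial>P i) * (\<Prod>j\<in>J. q j (y j))"
      using insert.hyps m[OF y] insert.prems(1)[of i]
      by (subst nn_integral_multc[symmetric])
         (simp_all add: measurable_cong_sets[OF sets_eq refl] mult.assoc borel_measurable_times_ennreal)
  qed
  also have "\<dots> \<le> (\<integral>\<^sup>+ y. (\<integral>\<^sup>+ x. F (y(i := x)) \<partial>Q i) * (\<Prod>j\<in>J. q j (y j)) \<partial>PiM J P)"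
    using m sets_eq_imp_space_eq[OF sets_PiM_eq[of J]]
    by (intro nn_integral_mono mult_right_mono insert.prems(2)) auto
  also have "\<dots> \<le> (\<integral>\<^sup>+ y. (\<integral>\<^sup>+ x. F (y(i := x)) \<partial>Q i) \<partial>PiM J Q)"
  proof (rule insert.IH)
    have "(\<lambda>(y, x). F (y(i := x))) \<in> borel_measurable (PiM J Q \<Otimes>\<^sub>M Q i)"
      by measurable
    then show "(\<lambda>y. \<integral>\<^sup>+ x. F (y(i := x)) \<partial>Q i) \<in> borel_measurable (PiM J Q)"
      using Q.sigma_finite_measures by (intro sigma_finite_measure.borel_measurable_nn_integral) auto
  qed (use insert.prems in auto)
  also have "\<dots> = (\<integral>\<^sup>+ y. F y \<partial>PiM (insert i J) Q)"
    using insert.hyps by (intro Q.product_nn_integral_insert[symmetric]) auto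
  finally show ?case .
qed

text \<open>
  A linearized form of the Donsker--Varadhan inequality for product measures. Let \<open>S\<close> be the
  log-likelihood ratio of \<open>P\<close> against \<open>Q\<close>, a sum over the coordinates. The inequality
  \<open>ln t \<le> t - 1\<close> at \<open>t = (1 + \<xi>) exp (- S)\<close> reads
  \<open>ln (1 + \<xi>) \<le> S + (1 + \<xi>) exp (- S) - 1\<close>. Under \<open>P\<close>, the mean of \<open>S\<close> is the sum of the
  divergences, and the mean of \<open>(1 + \<xi>) exp (- S)\<close> is at most the mean of \<open>1 + \<xi>\<close> under \<open>Q\<close>.
\<close>
lemma nn_integral_ln_le_KL_plus_expectation:
  fixes P Q :: "'i \<Rightarrow> 'b measure"
  assumes P: "\<And>i. prob_space (P i)" and Q: "\<And>i. prob_space (Q i)" and "finite J"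
    and sets_eq: "\<And>i. sets (P i) = sets (Q i)"
    and ac: "\<And>i. i \<in> J \<Longrightarrow> absolutely_continuous (Q i) (P i)"
    and int: "\<And>i. i \<in> J \<Longrightarrow> integrable (P i) (entropy_density (exp 1) (Q i) (P i))"
    and \<xi> [measurable]: "\<xi> \<in> borel_measurable (PiM J Q)" and \<xi>_nonneg: "\<And>y. 0 \<le> \<xi> y"
    and c: "(\<integral>\<^sup>+ y. ennreal (\<xi> y) \<partial>PiM J Q) \<le> ennreal c" "0 \<le> c"
  shows "(\<integral>\<^sup>+ y. ennreal (ln (1 + \<xi> y)) \<partial>PiM J P)
    \<le> ennreal ((\<Sum>i\<in>J. KL_divergence (exp 1) (Q i) (P i)) + c)"
proof -
  interpret P: product_prob_space P using P by (rule product_prob_spaceI)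
  interpret Q: product_prob_space Q using Q by (rule product_prob_spaceI)
  interpret PJ: prob_space "PiM J P" using P by (intro prob_space_PiM)
  interpret QJ: prob_space "PiM J Q" using Q by (intro prob_space_PiM)
  define s where "s i = entropy_density (exp 1) (Q i) (P i)" for i
  define S where "S y = (\<Sum>i\<in>J. s i (y i))" for y
  define T where "T y = (1 + \<xi> y) * exp (- S y)" for y
  have sets_PiM_eq: "sets (PiM J P) = sets (PiM J Q)"
    by (rule sets_PiM_cong) (simp_all add: sets_eq)
  have [measurable]: "s i \<in> borel_measurable (Q i)" for i
    by (simp add: s_def)
  have comp: "integrable (PiM J P) (\<lambda>y. s i (y i))"
    "(\<integral>y. s i (y i) \<partial>PiM J P) = KL_divergence (exp 1) (Q i) (P i)" if "i \<in> J" for i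
  proof -
    have d: "distr (PiM J P) (P i) (\<lambda>y. y i) = P i"
      using P \<open>finite J\<close> that by (intro distr_PiM_component) auto
    have sP: "s i \<in> borel_measurable (P i)"
      by (simp add: measurable_cong_sets[OF sets_eq refl])
    have c: "(\<lambda>y. y i) \<in> measurable (PiM J P) (P i)" using that by measurable
    show "integrable (PiM J P) (\<lambda>y. s i (y i))"
      using int[OF that] integrable_distr_eq[OF c sP] d by (simp add: s_def)
    show "(\<integral>y. s i (y i) \<partial>PiM J P) = KL_divergence (exp 1) (Q i) (P i)"
      using integral_distr[OF c sP] d by (simp add: s_def KL_divergence_def)
  qed
  have S: "integrable (PiM J P) S" "(\<integral>y. S y \<partial>PiM J P) = (\<Sum>i\<in>J. KL_divergence (exp 1) (Q i) (P i))"
    using comp by (auto simp: S_def[abs_def])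
  have mT: "T \<in> borel_measurable (PiM J P)"
    using S(1) \<xi> unfolding T_def[abs_def] measurable_cong_sets[OF sets_PiM_eq refl, symmetric]
    by measurable
  have T_nonneg: "0 \<le> T y" for y using \<xi>_nonneg[of y] by (simp add: T_def)
  have "(\<integral>\<^sup>+ y. ennreal (T y) \<partial>PiM J P)
      = (\<integral>\<^sup>+ y. ennreal (1 + \<xi> y) * (\<Prod>i\<in>J. ennreal (exp (- s i (y i)))) \<partial>PiM J P)"
    using \<xi>_nonneg \<open>finite J\<close>
    by (intro nn_integral_cong)
       (simp add: T_def S_def ennreal_mult' prod_ennreal exp_sum flip: sum_negf)
  also have "\<dots> \<le> (\<integral>\<^sup>+ y. ennreal (1 + \<xi> y) \<partial>PiM J Q)"
    using P Q \<open>finite J\<close> sets_eq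
    by (intro nn_integral_PiM_reweight_le P.product_sigma_finite_axioms Q.product_sigma_finite_axioms)
       (auto simp: s_def intro!: nn_integral_inverse_density_le ac prob_space_imp_sigma_finite
          prob_space.finite_measure)
  also have "\<dots> = 1 + (\<integral>\<^sup>+ y. ennreal (\<xi> y) \<partial>PiM J Q)"
    using \<xi>_nonneg by (simp add: nn_integral_add QJ.emeasure_space_1)
  also have "\<dots> \<le> 1 + ennreal c" using c by (intro add_left_mono)
  also have "\<dots> = ennreal (1 + c)" using c by simp
  finally have T_le: "(\<integral>\<^sup>+ y. ennreal (T y) \<partial>PiM J P) \<le> ennreal (1 + c)" .
  have T: "integrable (PiM J P) T"
    using mT T_nonneg T_le by (intro integrableI_nonneg) (auto intro: le_less_trans)
  have ET: "(\<integral>y. T y \<partial>PiM J P) \<le> 1 + c"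
    using T_le T_nonneg c by (simp add: nn_integral_eq_integral[OF T] ennreal_le_iff del: ennreal_plus)
  have ln_le: "ln (1 + \<xi> y) \<le> S y + T y - 1" for y
  proof -
    have pos: "0 < 1 + \<xi> y" using \<xi>_nonneg[of y] by simp
    then have "ln (T y) = ln (1 + \<xi> y) - S y" by (simp add: T_def ln_mult)
    moreover have "ln (T y) \<le> T y - 1" using pos by (intro ln_le_minus_one) (simp add: T_def)
    ultimately show ?thesis by simp
  qed
  have ln_nonneg: "0 \<le> ln (1 + \<xi> y)" for y using \<xi>_nonneg[of y] by simp
  have "(\<integral>\<^sup>+ y. ennreal (ln (1 + \<xi> y)) \<partial>PiM J P) \<le> (\<integral>\<^sup>+ y. ennreal (S y + T y - 1) \<partial>PiM J P)"
    using ln_le by (intro nn_integral_mono ennreal_leI)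
  also have "\<dots> = ennreal (\<integral>y. S y + T y - 1 \<partial>PiM J P)"
    using S T order_trans[OF ln_nonneg ln_le] by (intro nn_integral_eq_integral) auto
  also have "(\<integral>y. S y + T y - 1 \<partial>PiM J P) = (\<integral>y. S y \<partial>PiM J P) + (\<integral>y. T y \<partial>PiM J P) - 1"
    using S T by (simp add: PJ.prob_space)
  finally show ?thesis using S(2) ET by (auto elim!: order_trans intro!: ennreal_leI)
qed

text \<open>
  This form includes the empty index set, which occurs when no design point receives a positive
  weight.
\<close>
lemma (in prob_space) distr_eq_PiM_of_indep_vars:
  assumes "indep_vars M' X I"
  shows "distr M (PiM I M') (\<lambda>\<omega>. \<lambda>i\<in>I. X i \<omega>) = PiM I (\<lambda>i. distr M (M' i) (X i))"
proof (cases "I = {}")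
  case True
  have "(\<lambda>\<omega>. \<lambda>i\<in>{}. X i \<omega>) \<in> measurable M (PiM {} M')" by (rule measurable_restrict) simp
  then show ?thesis
    using True emeasure_space_1
    by (intro measure_eqI)
      (auto simp: emeasure_distr PiM_empty subset_singleton_iff vimage_def restrict_def)
next
  case False
  then show ?thesis
    using assms indep_vars_iff_distr_eq_PiM'[OF False, of X M'] by (auto simp: indep_vars_def)
qed

section \<open>The adaptive selection rule\<close>

lemma accepted_antimono: "accepted LR z e k \<Longrightarrow> j \<le> k \<Longrightarrow> accepted LR z e j"
  by (induction k) (auto simp: le_Suc_eq)

lemma adaptive_eq_accepted_estimate:
  assumes "accepted LR z e k" "k \<le> m"
  shows "\<exists>j\<in>{k..m}. accepted LR z e j \<and> adaptive LR z e m = e j"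
  using assms(2)
proof (induction m rule: dec_induct)
  case base
  show ?case using assms(1) by (cases k) auto
next
  case (step m)
  show ?case
  proof (cases "accepted LR z e (Suc m)")
    case True
    then show ?thesis using step.hyps by (intro bexI[of _ "Suc m"]) auto
  next
    case False
    then show ?thesis using step.IH by (auto simp del: accepted.simps)
  qed
qed

text \<open>
  A rejection is final, because acceptance at a step presupposes acceptance at all earlier ones.
\<close>
lemma adaptive_stays_after_rejection:
  assumes "\<not> accepted LR z e k" "k \<le> m"
  shows "adaptive LR z e m = adaptive LR z e k"
  using assms(2)
proof (induction m rule: dec_induct)
  case (step m)
  have "\<not> accepted LR z e (Suc m)"
    using assms(1) accepted_antimono[of LR z e "Suc m" k] step.hyps by auto
  then show ?case using step.IH by (simp del: accepted.simps)
qed simp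

text \<open>
  If step \<open>k\<close> is accepted, the final estimate is an accepted estimate of index at least \<open>k\<close>; if
  its index exceeds \<open>k\<close>, it has passed the test at level \<open>k\<close>, so the likelihood ratio is at most
  \<open>z k\<close>. If step \<open>k\<close> is rejected, the final estimate is already the adaptive estimate at step
  \<open>k\<close>.
\<close>
lemma adaptive_loss_le:
  assumes k: "1 \<le> k" "k \<le> m" and refl: "\<And>\<theta> l. LR \<theta> l \<theta> = 0"
    and nonneg: "\<And>j. j \<in> {1..m} \<Longrightarrow> 0 \<le> LR (e k) k (e j)" and "0 < r" "0 \<le> z k"
  shows "LR (e k) k (adaptive LR z e m) powr r \<le> z k powr r + LR (e k) k (adaptive LR z e k) powr r"
proof (cases "accepted LR z e k")
  case False
  then show ?thesis using adaptive_stays_after_rejection[OF False k(2)] by simp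
next
  case True
  then obtain j where j: "j \<in> {k..m}" "accepted LR z e j" "adaptive LR z e m = e j"
    using adaptive_eq_accepted_estimate[OF True k(2)] by auto
  have "LR (e k) k (e j) \<le> z k"
  proof (cases "j = k")
    case True
    then show ?thesis using refl \<open>0 \<le> z k\<close> by simp
  next
    case False
    then obtain j' where "j = Suc j'" "k \<le> j'" using j(1) by (cases j) auto
    then show ?thesis using j(2) k by auto
  qed
  then have "LR (e k) k (e j) powr r \<le> z k powr r"
    using nonneg[of j] j(1) k \<open>0 < r\<close> by (intro powr_mono2) auto
  then show ?thesis using j(3) by (simp add: add_increasing2)
qed

lemma accepted_cong:
  assumes "\<And>j. j \<in> {1..k} \<Longrightarrow> e j = e' j" "\<And>\<theta> j \<theta>'. j \<in> {1..k} \<Longrightarrow> LR \<theta> j \<theta>' = LR' \<theta> j \<theta>'"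
  shows "accepted LR z e k = accepted LR' z e' k"
  using assms by (induction k) auto

text \<open>
  For \<open>k \<ge> 1\<close> the dummy estimate at index \<open>0\<close> has no influence, since step \<open>1\<close> is always
  accepted.
\<close>
lemma adaptive_cong:
  assumes "1 \<le> k" and "\<And>j. j \<in> {1..k} \<Longrightarrow> e j = e' j"
    and "\<And>\<theta> j \<theta>'. j \<in> {1..k} \<Longrightarrow> LR \<theta> j \<theta>' = LR' \<theta> j \<theta>'"
  shows "adaptive LR z e k = adaptive LR' z e' k"
  using assms
proof (induction k rule: nat_induct_at_least)
  case base
  then show ?case by simp
next
  case (Suc k)
  have "accepted LR z e (Suc k) = accepted LR' z e' (Suc k)"
    using Suc.prems by (intro accepted_cong)
  then show ?case using Suc by (simp del: accepted.simps)
qed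

lemma measurable_accepted:
  assumes "\<And>l j. l \<in> {1..k} \<Longrightarrow> j \<in> {1..k} \<Longrightarrow> (\<lambda>y. LR y (e l y) l (e j y)) \<in> borel_measurable N"
  shows "Measurable.pred N (\<lambda>y. accepted (LR y) z (\<lambda>j. e j y) k)"
  using assms
proof (induction k)
  case (Suc k)
  have [measurable]: "Measurable.pred N (\<lambda>y. accepted (LR y) z (\<lambda>j. e j y) k)"
    using Suc.prems by (intro Suc.IH) auto
  have "Measurable.pred N (\<lambda>y. LR y (e l y) l (e (Suc k) y) \<le> z l)" if "l \<in> {1..k}" for l
  proof -
    have [measurable]: "(\<lambda>y. LR y (e l y) l (e (Suc k) y)) \<in> borel_measurable N"
      using Suc.prems[of l "Suc k"] that by auto
    show ?thesis by measurable
  qed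
  then show ?case by (auto intro!: pred_intros_logic pred_intros_finite)
qed simp

lemma measurable_adaptive:
  assumes "1 \<le> k" and "\<And>j. j \<in> {1..k} \<Longrightarrow> e j \<in> measurable N B"
    and "\<And>l j. l \<in> {1..k} \<Longrightarrow> j \<in> {1..k} \<Longrightarrow> (\<lambda>y. LR y (e l y) l (e j y)) \<in> borel_measurable N"
  shows "(\<lambda>y. adaptive (LR y) z (\<lambda>j. e j y) k) \<in> measurable N B"
  using assms
proof (induction k rule: nat_induct_at_least)
  case base
  then show ?case by simp
next
  case (Suc k)
  have "Measurable.pred N (\<lambda>y. accepted (LR y) z (\<lambda>j. e j y) (Suc k))"
    using Suc.prems by (intro measurable_accepted)
  moreover have "(\<lambda>y. adaptive (LR y) z (\<lambda>j. e j y) k) \<in> measurable N B"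
    using Suc.prems by (intro Suc.IH) auto
  moreover have "e (Suc k) \<in> measurable N B" using Suc.prems by auto
  ultimately show ?case by (simp del: accepted.simps add: measurable_If)
qed

section \<open>Local quasi-likelihood, modeling bias and kernel weights\<close>

text \<open>
  Observations of weight zero do not enter the objective. Since ties in the argmax are broken by
  the objective alone, the estimators do not depend on these observations either.
\<close>
lemma quasi_loglik_cong:
  assumes "\<And>i. i \<in> {1..n} \<Longrightarrow> w i \<noteq> 0 \<Longrightarrow> y i = y' i"
  shows "quasi_loglik \<tau> n \<Psi> y w = quasi_loglik \<tau> n \<Psi> y' w"
proof (rule ext)
  fix \<theta>
  have "(\<Sum>i=1..n. check_loss \<tau> (y i - \<Psi> i \<bullet> \<theta>) * w i) = (\<Sum>i=1..n. check_loss \<tau> (y' i - \<Psi> i \<bullet> \<theta>) * w i)"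
    using assms by (intro sum.cong refl) (metis mult_zero_right)
  then show "quasi_loglik \<tau> n \<Psi> y w \<theta> = quasi_loglik \<tau> n \<Psi> y' w \<theta>" by (simp add: quasi_loglik_def)
qed

lemma quasi_lr_measurable:
  assumes [measurable]: "e \<in> borel_measurable (PiM {1..n} (\<lambda>_. borel))"
    "e' \<in> borel_measurable (PiM {1..n} (\<lambda>_. borel))"
  shows "(\<lambda>y. quasi_lr \<tau> n \<Psi> y w (e y) (e' y)) \<in> borel_measurable (PiM {1..n} (\<lambda>_. borel))"
proof -
  have [measurable]: "check_loss \<tau> \<in> borel_measurable borel"
    unfolding check_loss_def of_bool_def by measurable
  show ?thesis unfolding quasi_lr_def quasi_loglik_def by measurable
qed

lemma quasi_lr_argmax_nonneg:
  assumes "argmax_estimator \<tau> n \<Psi> \<Theta> w est" "\<theta> \<in> \<Theta>"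
  shows "0 \<le> quasi_lr \<tau> n \<Psi> y w (est y) \<theta>"
  using assms unfolding argmax_estimator_def quasi_lr_def is_arg_max_def
  by (metis diff_ge_0_iff_ge linorder_not_less)

text \<open>
  The divergence never takes the value \<open>-\<infinity>\<close>, so a single infinite term would make the bias
  infinite. Hence at every coordinate of positive weight the divergence is a genuine integral.
\<close>
lemma modeling_bias_finiteD:
  assumes "modeling_bias M n \<epsilon> \<Psi> fX w \<theta> \<le> ereal \<Delta>"
  defines "P \<equiv> \<lambda>i. shifted_law M (\<epsilon> i) (fX i)" and "Q \<equiv> \<lambda>i. shifted_law M (\<epsilon> i) (\<Psi> i \<bullet> \<theta>)"
    and "J \<equiv> {i\<in>{1..n}. 0 < w i}"
  shows "\<And>i. i \<in> J \<Longrightarrow> absolutely_continuous (Q i) (P i)"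
    and "\<And>i. i \<in> J \<Longrightarrow> integrable (P i) (entropy_density (exp 1) (Q i) (P i))"
    and "(\<Sum>i\<in>J. KL_divergence (exp 1) (Q i) (P i)) \<le> \<Delta>"
proof -
  have bias: "modeling_bias M n \<epsilon> \<Psi> fX w \<theta> = (\<Sum>i\<in>J. KL (P i) (Q i))"
    unfolding modeling_bias_def P_def Q_def J_def
    by (intro sum.mono_neutral_cong_right) (auto simp: indicator_def)
  then have "(\<Sum>i\<in>J. KL (P i) (Q i)) \<noteq> \<infinity>" using assms(1) by auto
  moreover have "finite J" by (simp add: J_def)
  ultimately have fin: "KL (P i) (Q i) \<noteq> \<infinity>" if "i \<in> J" for i
    using that by (auto simp: sum_Pinfty)
  then show "absolutely_continuous (Q i) (P i)" "integrable (P i) (entropy_density (exp 1) (Q i) (P i))"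
    if "i \<in> J" for i using fin[OF that] by (auto simp: KL_def split: if_splits)
  have "KL (P i) (Q i) = ereal (KL_divergence (exp 1) (Q i) (P i))" if "i \<in> J" for i
    using fin[OF that] by (auto simp: KL_def split: if_splits)
  then show "(\<Sum>i\<in>J. KL_divergence (exp 1) (Q i) (P i)) \<le> \<Delta>"
    using assms(1) bias by simp
qed

text \<open>
  Enlarging the bandwidth moves the argument of the kernel towards zero. Thus the local models
  are nested: every observation that is used with a smaller bandwidth is used with a larger one.
\<close>
lemma kernel_weight_pos_of_smaller_bandwidth:
  fixes Kloc :: "real \<Rightarrow> real"
  assumes even: "\<And>u. Kloc (- u) = Kloc u" and dec: "antimono_on {0..} Kloc"
    and supp: "\<And>u. 1 \<le> \<bar>u\<bar> \<Longrightarrow> Kloc u = 0" and h: "0 < h" "h \<le> h'" and "Kloc (v / h) \<noteq> 0"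
  shows "0 < Kloc (v / h')"
proof -
  have abs: "Kloc \<bar>u\<bar> = Kloc u" for u using even[of u] by (auto simp: abs_if)
  have mono: "Kloc b \<le> Kloc a" if "0 \<le> a" "a \<le> b" for a b
    using dec that by (auto simp: monotone_on_def)
  have nonneg: "0 \<le> Kloc u" for u
    using mono[of "\<bar>u\<bar>" "max 1 \<bar>u\<bar>"] supp[of "max 1 \<bar>u\<bar>"] abs[of u] by auto
  have "\<bar>v / h'\<bar> \<le> \<bar>v / h\<bar>" using h by (simp add: frac_le)
  then have "Kloc (v / h) \<le> Kloc (v / h')" using mono[of "\<bar>v / h'\<bar>" "\<bar>v / h\<bar>"] unfolding abs by simp
  then show ?thesis using nonneg[of "v / h"] assms(6) by linarith
qed

lemma ln_one_plus_add_le: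
  fixes a b :: real
  assumes "0 \<le> a" "0 \<le> b"
  shows "ln (1 + (a + b)) \<le> ln (1 + a) + ln (1 + b)"
proof -
  have "1 + (a + b) \<le> (1 + a) * (1 + b)" using assms by (simp add: algebra_simps)
  then have "ln (1 + (a + b)) \<le> ln ((1 + a) * (1 + b))" using assms by (subst ln_le_cancel_iff) (auto intro: add_pos_nonneg)
  then show ?thesis using assms by (simp add: ln_mult add_pos_nonneg)
qed

section \<open>The oracle inequality\<close>

theorem theorem5p2:
  fixes M :: "'a measure" and Y \<epsilon> :: "nat \<Rightarrow> 'a \<Rightarrow> real"
    and n p K kstar :: nat
    and \<tau> x \<uu>0 \<uu> \<aa> \<delta> \<rho> \<Delta> \<alpha> r R :: real
    and X h \<zz> :: "nat \<Rightarrow> real" and f Kloc :: "real \<Rightarrow> real"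
    and dens :: "nat \<Rightarrow> real \<Rightarrow> real"
    and ix :: "'m::finite \<Rightarrow> nat" and \<Theta> :: "(real^'m) set" and \<theta>star :: "real^'m"
    and \<Psi> :: "nat \<Rightarrow> real^'m" and w :: "nat \<Rightarrow> nat \<Rightarrow> real"
    and D2 V2 D :: "nat \<Rightarrow> real^'m^'m"
    and LR :: "(nat \<Rightarrow> real) \<Rightarrow> real^'m \<Rightarrow> nat \<Rightarrow> real^'m \<Rightarrow> real"
    and est adapt :: "nat \<Rightarrow> (nat \<Rightarrow> real) \<Rightarrow> real^'m"
  assumes "prob_space M" and "0 < \<tau>" "\<tau> < 1"
    \<comment> \<open>notation\<close>
    and ix: "bij_betw ix UNIV {0..p}"
    and \<Psi>: "\<Psi> = (\<lambda>i. local_basis ix x (X i))"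
    and w: "w = (\<lambda>k i. Kloc ((X i - x) / h k))"
    and LR: "LR = (\<lambda>y \<theta> k \<theta>'. quasi_lr \<tau> n \<Psi> y (w k) \<theta> \<theta>')"
    and D2: "D2 = (\<lambda>k. D_squared n \<Psi> dens (w k))"
    and V2: "V2 = (\<lambda>k. V_squared \<tau> n \<Psi> (w k))"
    and D: "D = (\<lambda>k. matrix_sqrt (D2 k))"
    and adapt: "adapt = (\<lambda>k y. adaptive (LR y) \<zz> (\<lambda>j. est j y) k)"
    and eps: "\<epsilon> = (\<lambda>i \<omega>. Y i \<omega> - f (X i))"
    \<comment> \<open>model\<close>
    and quantile: "\<And>i. i \<in> {1..n} \<Longrightarrow> {q. measure M {\<omega> \<in> space M. Y i \<omega> > q} = \<tau>} = {f (X i)}"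
    and density: "\<And>i. i \<in> {1..n} \<Longrightarrow> distributed M lborel (\<epsilon> i) (\<lambda>u. ennreal (dens i u))"
    and density_nonneg: "\<And>i u. i \<in> {1..n} \<Longrightarrow> 0 \<le> dens i u"
    and bandwidths: "strict_mono_on {1..K} h" "\<And>k. k \<in> {1..K} \<Longrightarrow> 0 < h k"
    and est: "\<And>k. k \<in> {1..K} \<Longrightarrow> argmax_estimator \<tau> n \<Psi> \<Theta> (w k) (est k)"
    \<comment> \<open>conditions (1) to (5)\<close>
    and c1: "prob_space.indep_vars M (\<lambda>_. borel) Y {1..n}"
    and c2: "0 < \<uu>0" "\<uu>0 < \<uu>" "\<uu> < 1"
      "\<And>k. k \<in> {2..K} \<Longrightarrow> invertible (D k) \<and>
         \<uu>0 \<le> spectral_norm (matrix_inv (D k) ** D2 (k - 1) ** matrix_inv (D k)) \<and>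
         spectral_norm (matrix_inv (D k) ** D2 (k - 1) ** matrix_inv (D k)) \<le> \<uu>"
    and c3: "0 < \<aa>" "\<And>k. k \<in> {1..K} \<Longrightarrow> psd_matrix (\<aa>\<^sup>2 *\<^sub>R D2 k - V2 k)"
    and c4: "\<delta> < 1/2" "0 < \<rho>"
      "\<And>i u. i \<in> {1..n} \<Longrightarrow> \<bar>u\<bar> \<le> \<rho> \<Longrightarrow> \<bar>dens i u / dens i 0 - 1\<bar> \<le> \<delta>"
    and c5: "\<And>u. Kloc (- u) = Kloc u" "Kloc 0 = 1" "antimono_on {0..} Kloc"
      "\<And>u. 1 \<le> \<bar>u\<bar> \<Longrightarrow> Kloc u = 0"
    \<comment> \<open>small modeling bias\<close>
    and "\<theta>star \<in> \<Theta>" and "0 < \<Delta>" and "kstar \<in> {1..K}"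
    and smb: "modeling_bias M n \<epsilon> \<Psi> (\<lambda>i. f (X i)) (w kstar) \<theta>star \<le> ereal \<Delta>"
    \<comment> \<open>propagation condition\<close>
    and "0 < \<alpha>" and "0 < r" and "0 < R" and "0 \<le> \<zz> kstar"
    and risk: "\<And>k. k \<in> {1..K} \<Longrightarrow>
      (\<integral>\<^sup>+ y. ennreal (LR y (est k y) k \<theta>star powr r) \<partial>param_measure M n \<epsilon> \<Psi> \<theta>star) \<le> ennreal R"
    and propagation: "\<And>k. k \<in> {2..K} \<Longrightarrow>
      (\<integral>\<^sup>+ y. ennreal (LR y (est k y) k (adapt k y) powr r) \<partial>param_measure M n \<epsilon> \<Psi> \<theta>star)
        \<le> ennreal (\<alpha> * R)"
  shows "(\<integral>\<^sup>+ \<omega>. (let y = (\<lambda>i\<in>{1..n}. Y i \<omega>) in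
            ennreal (ln (1 + LR y (est kstar y) kstar (adapt K y) powr r / R))) \<partial>M)
         \<le> ennreal (\<alpha> + \<Delta> + ln (1 + \<zz> kstar powr r / R))"
proof -
  interpret prob_space M by fact
  define I where "I = {1..n}"
  define J where "J = {i\<in>I. 0 < w kstar i}"
  have J: "finite J" "J \<subseteq> I" "finite I" by (auto simp: J_def I_def)
  have kstar: "1 \<le> kstar" "kstar \<le> K" using \<open>kstar \<in> {1..K}\<close> by auto
  have Y: "Y i \<in> borel_measurable M" if "i \<in> I" for i
    using c1 that by (simp add: indep_vars_def I_def)

  \<comment> \<open>Outside \<open>I\<close> both families are point masses, so that they are probability measures at every
    index.\<close>
  define P where "P i = distr M borel (if i \<in> I then Y i else (\<lambda>_. 0))" for i
  define Q where "Q i = distr M borel (\<lambda>\<omega>. if i \<in> I then \<Psi> i \<bullet> \<theta>star + \<epsilon> i \<omega> else 0)" for i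
  have prob: "prob_space (P i)" "prob_space (Q i)" for i
    using Y[of i] by (cases "i \<in> I"; simp add: P_def Q_def eps prob_space_distr del: distr_const)+
  have sets: "sets (P i) = sets borel" "sets (Q i) = sets borel" for i
    by (simp_all add: P_def Q_def)
  have law: "shifted_law M (\<epsilon> i) (f (X i)) = P i" "shifted_law M (\<epsilon> i) (\<Psi> i \<bullet> \<theta>star) = Q i"
    if "i \<in> I" for i using that by (simp_all add: shifted_law_def P_def Q_def eps)
  have param: "param_measure M n \<epsilon> \<Psi> \<theta>star = PiM I Q"
    unfolding param_measure_def I_def[symmetric] using law by (intro PiM_cong) auto
  have sets_PiM: "sets (PiM L Q) = sets (PiM L (\<lambda>_. borel))" for L
    by (rule sets_PiM_cong) (simp_all add: sets)
  have bias: "\<And>i. i \<in> J \<Longrightarrow> absolutely_continuous (Q i) (P i)"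
    "\<And>i. i \<in> J \<Longrightarrow> integrable (P i) (entropy_density (exp 1) (Q i) (P i))"
    "(\<Sum>i\<in>J. KL_divergence (exp 1) (Q i) (P i)) \<le> \<Delta>"
    using modeling_bias_finiteD[OF smb] law by (auto simp: J_def I_def)

  have weight_zero: "w k i = 0" if "k \<in> {1..kstar}" "i \<in> I - J" for k i
  proof (rule ccontr)
    assume "w k i \<noteq> 0"
    moreover have "h k \<le> h kstar"
      using bandwidths(1) that(1) kstar by (cases "k = kstar") (auto simp: strict_mono_on_def less_imp_le)
    ultimately have "0 < w kstar i"
      using bandwidths(2)[of k] that(1) kstar c5
      unfolding w by (intro kernel_weight_pos_of_smaller_bandwidth[of Kloc "h k"]) auto
    then show False using that(2) by (simp add: J_def)
  qed

  define U where "U y = LR y (est kstar y) kstar (adapt kstar y)" for y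
  define \<xi> where "\<xi> y = U y powr r / R" for y
  have \<xi>_nonneg: "0 \<le> \<xi> y" for y using \<open>0 < R\<close> by (simp add: \<xi>_def)

  have est_measurable: "est k \<in> borel_measurable (PiM I (\<lambda>_. borel))" if "k \<in> {1..K}" for k
    using est[OF that] by (simp add: argmax_estimator_def I_def)
  have LR_measurable: "(\<lambda>y. LR y (e y) k (e' y)) \<in> borel_measurable (PiM I (\<lambda>_. borel))"
    if "e \<in> borel_measurable (PiM I (\<lambda>_. borel))" "e' \<in> borel_measurable (PiM I (\<lambda>_. borel))"
    for e e' k using that unfolding LR I_def by (rule quasi_lr_measurable)
  have "adapt kstar \<in> borel_measurable (PiM I (\<lambda>_. borel))"
    unfolding adapt using kstar est_measurable
    by (intro measurable_adaptive LR_measurable) auto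
  then have U_measurable: "U \<in> borel_measurable (PiM I (\<lambda>_. borel))"
    unfolding U_def[abs_def] using est_measurable[OF \<open>kstar \<in> {1..K}\<close>] by (intro LR_measurable)
  then have \<xi>_measurable: "\<xi> \<in> borel_measurable (PiM I (\<lambda>_. borel))"
    unfolding \<xi>_def[abs_def] by measurable

  have \<xi>_local: "\<xi> y = \<xi> y'" if agree: "\<And>i. i \<in> J \<Longrightarrow> y i = y' i" for y y'
  proof -
    have L: "quasi_loglik \<tau> n \<Psi> y (w k) = quasi_loglik \<tau> n \<Psi> y' (w k)" if "k \<in> {1..kstar}" for k
      using weight_zero[OF that] agree by (intro quasi_loglik_cong) (auto simp: I_def)
    have e: "est k y = est k y'" if "k \<in> {1..kstar}" for k
    proof -
      have "k \<in> {1..K}" using that kstar by simp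
      then show ?thesis using est L[OF that] unfolding argmax_estimator_def by blast
    qed
    have lr: "LR y \<theta> k \<theta>' = LR y' \<theta> k \<theta>'" if "k \<in> {1..kstar}" for \<theta> k \<theta>'
      using L[OF that] by (simp add: LR quasi_lr_def)
    have "adapt kstar y = adapt kstar y'"
      unfolding adapt using kstar e lr by (intro adaptive_cong) auto
    then show ?thesis using e[of kstar] lr[of kstar] kstar by (simp add: \<xi>_def U_def)
  qed
  \<comment> \<open>\<open>E\<close> fills in the irrelevant coordinates with zeros. It exhibits \<open>\<xi>\<close> as a measurable function
    on the product over \<open>J\<close>.\<close>
  define E :: "(nat \<Rightarrow> real) \<Rightarrow> nat \<Rightarrow> real" where "E z = (\<lambda>i\<in>I. if i \<in> J then z i else 0)" for z
  have "E \<in> measurable (PiM J (\<lambda>_. borel)) (PiM I (\<lambda>_. borel))"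
    unfolding E_def[abs_def]
  proof (rule measurable_restrict)
    fix i show "(\<lambda>z. if i \<in> J then z i else 0 :: real) \<in> borel_measurable (PiM J (\<lambda>_. borel))"
      by (cases "i \<in> J") auto
  qed
  then have \<xi>E: "(\<lambda>z. \<xi> (E z)) \<in> borel_measurable (PiM J (\<lambda>_. borel))"
    using \<xi>_measurable by (rule measurable_compose)
  have \<xi>_restrict: "\<xi> (E (restrict y J)) = \<xi> y" for y
    using J by (intro \<xi>_local) (auto simp: E_def)

  have expect_\<xi>: "(\<integral>\<^sup>+ y. ennreal (\<xi> y) \<partial>PiM I Q) \<le> ennreal \<alpha>"
  \<comment> \<open>The propagation condition starts at the second step; at the first one the adaptive estimate
      is the local estimate and the loss vanishes.\<close>
  proof (cases "kstar = 1")
    case True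
    then have "\<xi> y = 0" for y by (simp add: \<xi>_def U_def adapt LR quasi_lr_def)
    then show ?thesis by simp
  next
    case False
    have "(\<integral>\<^sup>+ y. ennreal (\<xi> y) \<partial>PiM I Q) = (\<integral>\<^sup>+ y. ennreal (U y powr r) / ennreal R \<partial>PiM I Q)"
      using \<open>0 < R\<close> by (intro nn_integral_cong) (simp add: \<xi>_def divide_ennreal)
    also have "\<dots> = (\<integral>\<^sup>+ y. ennreal (U y powr r) \<partial>PiM I Q) / ennreal R"
      using U_measurable by (intro nn_integral_divide) (simp add: measurable_cong_sets[OF sets_PiM refl])
    also have "\<dots> \<le> ennreal (\<alpha> * R) / ennreal R"
      using propagation[of kstar] False kstar unfolding param U_def
      by (intro divide_right_mono_ennreal) auto
    also have "\<dots> = ennreal \<alpha>" using \<open>0 < R\<close> \<open>0 < \<alpha>\<close> by (simp add: divide_ennreal)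
    finally show ?thesis .
  qed
  interpret Q: product_prob_space Q using prob(2) by (rule product_prob_spaceI)
  have "(\<integral>\<^sup>+ z. ennreal (\<xi> (E z)) \<partial>PiM J Q)
      = (\<integral>\<^sup>+ z. ennreal (\<xi> (E z)) \<partial>distr (PiM I Q) (PiM J Q) (\<lambda>y. restrict y J))"
    using Q.distr_restrict[OF J(2,3)] by simp
  also have "\<dots> = (\<integral>\<^sup>+ y. ennreal (\<xi> (E (restrict y J))) \<partial>PiM I Q)"
    using J \<xi>E by (intro nn_integral_distr measurable_restrict_subset)
      (simp_all add: measurable_cong_sets[OF sets_PiM refl])
  finally have expect_\<xi>E: "(\<integral>\<^sup>+ z. ennreal (\<xi> (E z)) \<partial>PiM J Q) \<le> ennreal \<alpha>"
    using expect_\<xi> by (simp add: \<xi>_restrict)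

  define y where "y \<omega> = (\<lambda>i\<in>I. Y i \<omega>)" for \<omega>
  have y_J: "\<xi> (y \<omega>) = \<xi> (E (\<lambda>i\<in>J. Y i \<omega>))" for \<omega>
    using J by (intro \<xi>_local) (auto simp: y_def E_def)
  have Y_J: "(\<lambda>\<omega>. \<lambda>i\<in>J. Y i \<omega>) \<in> measurable M (PiM J (\<lambda>_. borel))"
    using Y J by (intro measurable_restrict) auto
  have law_J: "distr M (PiM J (\<lambda>_. borel)) (\<lambda>\<omega>. \<lambda>i\<in>J. Y i \<omega>) = PiM J P"
  proof -
    have "indep_vars (\<lambda>_. borel) Y J" using c1 J(2) unfolding I_def by (rule indep_vars_subset)
    then have "distr M (PiM J (\<lambda>_. borel)) (\<lambda>\<omega>. \<lambda>i\<in>J. Y i \<omega>) = PiM J (\<lambda>i. distr M borel (Y i))"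
      by (rule distr_eq_PiM_of_indep_vars)
    also have "\<dots> = PiM J P" using J by (intro PiM_cong) (auto simp: P_def)
    finally show ?thesis .
  qed
  have "(\<integral>\<^sup>+ \<omega>. ennreal (ln (1 + \<xi> (y \<omega>))) \<partial>M) = (\<integral>\<^sup>+ z. ennreal (ln (1 + \<xi> (E z))) \<partial>PiM J P)"
    unfolding y_J law_J[symmetric] using Y_J \<xi>E by (subst nn_integral_distr) auto
  also have "\<dots> \<le> ennreal ((\<Sum>i\<in>J. KL_divergence (exp 1) (Q i) (P i)) + \<alpha>)"
  proof (rule nn_integral_ln_le_KL_plus_expectation[OF prob J(1) _ bias(1,2)])
    show "(\<lambda>z. \<xi> (E z)) \<in> borel_measurable (PiM J Q)"
      using \<xi>E by (simp add: measurable_cong_sets[OF sets_PiM refl])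
  qed (use \<xi>_nonneg expect_\<xi>E \<open>0 < \<alpha>\<close> in \<open>simp_all add: sets\<close>)
  also have "\<dots> \<le> ennreal (\<Delta> + \<alpha>)" using bias(3) by (intro ennreal_leI) simp
  finally have propagated: "(\<integral>\<^sup>+ \<omega>. ennreal (ln (1 + \<xi> (y \<omega>))) \<partial>M) \<le> ennreal (\<Delta> + \<alpha>)" .

  let ?c = "ln (1 + \<zz> kstar powr r / R)"
  have c_nonneg: "0 \<le> ?c" using \<open>0 < R\<close> by simp
  have stable: "ln (1 + LR v (est kstar v) kstar (adapt K v) powr r / R) \<le> ?c + ln (1 + \<xi> v)" for v
  proof -
    have "LR v (est kstar v) kstar (adapt K v) powr r \<le> \<zz> kstar powr r + U v powr r"
      unfolding U_def adapt
    proof (rule adaptive_loss_le[where e = "\<lambda>j. est j v"])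
      show "0 \<le> LR v (est kstar v) kstar (est j v)" if "j \<in> {1..K}" for j
      proof -
        have "est j v \<in> \<Theta>"
          using est[OF that] unfolding argmax_estimator_def is_arg_max_def by blast
        then show ?thesis
          unfolding LR by (rule quasi_lr_argmax_nonneg[OF est[OF \<open>kstar \<in> {1..K}\<close>]])
      qed
    qed (use kstar \<open>0 < r\<close> \<open>0 \<le> \<zz> kstar\<close> in \<open>auto simp: LR quasi_lr_def\<close>)
    then have "LR v (est kstar v) kstar (adapt K v) powr r / R \<le> \<zz> kstar powr r / R + \<xi> v"
      using \<open>0 < R\<close> by (simp add: \<xi>_def field_simps)
    then have "ln (1 + LR v (est kstar v) kstar (adapt K v) powr r / R) \<le> ln (1 + (\<zz> kstar powr r / R + \<xi> v))"
      using \<open>0 < R\<close> by (subst ln_le_cancel_iff) (auto intro!: add_pos_nonneg simp: \<xi>_nonneg)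
    also have "\<dots> \<le> ?c + ln (1 + \<xi> v)" using \<open>0 < R\<close> \<xi>_nonneg by (intro ln_one_plus_add_le) auto
    finally show ?thesis .
  qed
  have "(\<lambda>\<omega>. \<xi> (y \<omega>)) \<in> borel_measurable M"
    unfolding y_J using Y_J \<xi>E by (rule measurable_compose)
  note [measurable] = this
  have "(\<integral>\<^sup>+ \<omega>. ennreal (ln (1 + LR (y \<omega>) (est kstar (y \<omega>)) kstar (adapt K (y \<omega>)) powr r / R)) \<partial>M)
      \<le> (\<integral>\<^sup>+ \<omega>. ennreal ?c + ennreal (ln (1 + \<xi> (y \<omega>))) \<partial>M)"
  proof (rule nn_integral_mono)
    fix \<omega>
    show "ennreal (ln (1 + LR (y \<omega>) (est kstar (y \<omega>)) kstar (adapt K (y \<omega>)) powr r / R))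
        \<le> ennreal ?c + ennreal (ln (1 + \<xi> (y \<omega>)))"
      using ennreal_leI[OF stable[of "y \<omega>"]] c_nonneg \<xi>_nonneg[of "y \<omega>"] by simp
  qed
  also have "\<dots> = ennreal ?c + (\<integral>\<^sup>+ \<omega>. ennreal (ln (1 + \<xi> (y \<omega>))) \<partial>M)"
    by (subst nn_integral_add) (auto simp: emeasure_space_1)
  also have "\<dots> \<le> ennreal ?c + ennreal (\<Delta> + \<alpha>)" using propagated by (intro add_left_mono)
  also have "\<dots> = ennreal (\<alpha> + \<Delta> + ?c)"
    using c_nonneg \<open>0 < \<alpha>\<close> \<open>0 < \<Delta>\<close> by (simp flip: ennreal_plus add: ac_simps)
  finally show ?thesis by (simp add: Let_def y_def I_def)
qed

end
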